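(* Let $G=(V,E)$ be a finite connected simple graph. Then $$\chi^{\mathrm{FAT}}(G)\leq \gcd\{\deg v: v\in V\}+1.$$ Moreover, if equality holds, then every FAT $\chi^{\mathrm{FAT}}(G)$-coloring of $G$ is a proper equitable coloring, i.e. a FAT coloring with $\beta=0$ (no vertex has a neighbor of its own color).
   Context: For $v\in V$ and $S\subseteq V$, let $e(v,S)$ denote the number of neighbors of $v$ in $S$. A vertex $k$-coloring of $G$ is a function $c:V\to\{1,\ldots,k\}$ with coloring classes $V_i=c^{-1}(i)$. It is Fair and Tolerant (FAT) if there exists $\alpha\in[0,1]$ such that, with $\beta:=1-(k-1)\alpha$, for every vertex $v$ and every $i$ we have $e(v,V_i)=\alpha\deg v$ if $v\notin V_i$ and $e(v,V_i)=\beta\deg v$ if $v\in V_i$. A FAT coloring with $\beta=0$ is exactly a proper coloring in which every vertex has the same number $\deg v/(k-1)$ of neighbors in each other class; the paper calls such colorings proper equitable colorings. The FAT chromatic number $\chi^{\mathrm{FAT}}(G)$ is the largest integer $k$ such that $G$ admits a FAT $k$-coloring.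
   Formalization: A k-coloring is required to use all k colors (otherwise constant colorings are FAT for every k and no largest k exists), and β=0 is claimed only for graphs with at least two vertices, since on one vertex k=1 gives β=1; there only "no neighbor of its own color" is claimed. *)

theory Defs
  imports Complex_Main "Graph_Theory.Digraph_Component"
begin

text \<open>
  Finite simple graphs are those of the locale \<^locale>\<open>graph\<close>: every undirected edge is represented
  by its two orientations, so the degree of a vertex is its \<^const>\<open>out_degree\<close>.
\<close>

definition nbrs_in :: "('a, 'b) pre_digraph \<Rightarrow> 'a \<Rightarrow> 'a set \<Rightarrow> nat" where
  "nbrs_in G v S = card {u \<in> S. v \<rightarrow>\<^bsub>G\<^esub> u}"

definition color_class :: "('a, 'b) pre_digraph \<Rightarrow> ('a \<Rightarrow> nat) \<Rightarrow> nat \<Rightarrow> 'a set" where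
  "color_class G c i = {v \<in> verts G. c v = i}"

text \<open>
  All \<open>k\<close> colors are used. If color classes could be empty, then \<open>\<alpha> = 0\<close> and a constant
  coloring would be FAT for every \<open>k\<close>, and there would be no largest such \<open>k\<close>.
\<close>

definition vertex_coloring :: "('a, 'b) pre_digraph \<Rightarrow> nat \<Rightarrow> ('a \<Rightarrow> nat) \<Rightarrow> bool" where
  "vertex_coloring G k c \<longleftrightarrow> c ` verts G = {1..k}"

definition fat_beta :: "nat \<Rightarrow> real \<Rightarrow> real" where
  "fat_beta k \<alpha> = 1 - (real k - 1) * \<alpha>"

definition fat_coloring_with ::
    "('a, 'b) pre_digraph \<Rightarrow> nat \<Rightarrow> real \<Rightarrow> ('a \<Rightarrow> nat) \<Rightarrow> bool" where
  "fat_coloring_with G k \<alpha> c \<longleftrightarrow>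
     vertex_coloring G k c \<and> \<alpha> \<in> {0..1} \<and>
     (\<forall>v \<in> verts G. \<forall>i \<in> {1..k}.
        (v \<notin> color_class G c i \<longrightarrow>
           real (nbrs_in G v (color_class G c i)) = \<alpha> * real (out_degree G v)) \<and>
        (v \<in> color_class G c i \<longrightarrow>
           real (nbrs_in G v (color_class G c i)) = fat_beta k \<alpha> * real (out_degree G v)))"

definition fat_coloring :: "('a, 'b) pre_digraph \<Rightarrow> nat \<Rightarrow> ('a \<Rightarrow> nat) \<Rightarrow> bool" where
  "fat_coloring G k c \<longleftrightarrow> (\<exists>\<alpha>. fat_coloring_with G k \<alpha> c)"

text \<open>
  Pitfall: for \<open>k = 1\<close> the parameter \<open>\<beta>\<close> is always \<open>1\<close>. Hence the coloring of the one-vertex graph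
  is never proper equitable in the following sense, although no vertex has a neighbor of its own color.
\<close>

definition proper_equitable_coloring :: "('a, 'b) pre_digraph \<Rightarrow> nat \<Rightarrow> ('a \<Rightarrow> nat) \<Rightarrow> bool" where
  "proper_equitable_coloring G k c \<longleftrightarrow> (\<exists>\<alpha>. fat_coloring_with G k \<alpha> c \<and> fat_beta k \<alpha> = 0)"

text \<open>
  For a finite nonempty graph the maximum exists: \<open>k = 1\<close> is always admissible (with \<open>\<beta> = 1\<close>), and
  \<open>k\<close> is at most the number of vertices, since every color is used.
\<close>

definition fat_chromatic_number :: "('a, 'b) pre_digraph \<Rightarrow> nat" where
  "fat_chromatic_number G = (GREATEST k. \<exists>c. fat_coloring G k c)"

end

theory Submission
  imports Defs
begin

text \<open>
  In a FAT \<open>k\<close>-coloring with \<open>k \<ge> 2\<close>, connectedness yields an arc between two colors, so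
  \<open>\<alpha> > 0\<close> and some degree is positive. Every \<open>\<alpha> deg v\<close> is a neighbor count, hence an integer,
  and by Bezout so is \<open>\<alpha> g\<close> for the gcd \<open>g\<close> of the degrees; thus \<open>\<alpha> g \<ge> 1\<close>. As \<open>\<beta> \<ge> 0\<close>
  means \<open>(k - 1) \<alpha> \<le> 1\<close>, we get \<open>k - 1 \<le> (k - 1) \<alpha> g \<le> g\<close>, and equality forces
  \<open>(k - 1) \<alpha> = 1\<close>, that is \<open>\<beta> = 0\<close>.
\<close>

text \<open>The naturals \<open>n\<close> with \<open>\<alpha> * n\<close> an integer are closed
  under those integer combinations that stay natural; Bezout writes each gcd as such a combination,
  one element of \<open>S\<close> at a time.\<close>

lemma mult_Gcd_in_Ints:
  fixes \<alpha> :: real and S :: "nat set"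
  assumes "finite S" and "\<And>x. x \<in> S \<Longrightarrow> \<alpha> * real x \<in> \<int>"
  shows "\<alpha> * real (Gcd S) \<in> \<int>"
  using assms
proof (induction S rule: finite_induct)
  case empty
  then show ?case by simp
next
  case (insert a S)
  obtain u v :: int where uv: "u * int a + v * int (Gcd S) = gcd (int a) (int (Gcd S))"
    using bezout_int by blast
  have "real (Gcd (insert a S)) = of_int (gcd (int a) (int (Gcd S)))"
    by simp
  also have "\<dots> = of_int u * real a + of_int v * real (Gcd S)"
    unfolding uv[symmetric] by simp
  finally have "\<alpha> * real (Gcd (insert a S)) =
      of_int u * (\<alpha> * real a) + of_int v * (\<alpha> * real (Gcd S))"
    by (simp add: algebra_simps)
  then show ?case
    using insert by (simp add: Ints_add Ints_mult)
qed

context graph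
begin

text \<open>The function \<open>f\<close> stays general for two uses: a coloring, to find an arc
  between two colors, and the identity, to show that a connected graph without arcs has at most one
  vertex.\<close>

lemma constant_on_connected:
  assumes conn: "connected G"
    and arc: "\<And>u v. u \<rightarrow> v \<Longrightarrow> f u = f v"
    and "u \<in> verts G" "v \<in> verts G"
  shows "f u = f v"
proof -
  have "u \<rightarrow>\<^sup>*\<^bsub>mk_symmetric G\<^esub> v"
    using conn assms(3,4) unfolding connected_def by auto
  \<comment> \<open>Arcs come in both orientations, so the symmetric closure adds no
    reachability.\<close>
  then have "u \<rightarrow>\<^sup>* v"
    using reachable_mk_symmetric_eq sym_arcs by blast
  then show ?thesis
    by (induction rule: reachable_induct) (auto dest: arc)
qed

lemma nbrs_in_pos_iff: "nbrs_in G v (color_class G c i) > 0 \<longleftrightarrow> (\<exists>u. v \<rightarrow> u \<and> c u = i)"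
proof -
  have "finite {u \<in> color_class G c i. v \<rightarrow> u}"
    by (simp add: color_class_def)
  then show ?thesis
    by (auto simp: nbrs_in_def card_gt_0_iff color_class_def dest: adj_in_verts(2))
qed

text \<open>The left side counts vertices and the right side arcs; without parallel arcs,
  \<open>head G\<close> is a bijection from the arcs leaving \<open>v\<close> to its
  neighbors.\<close>

lemma nbrs_in_verts: "nbrs_in G v (verts G) = out_degree G v"
proof -
  have "inj_on (head G) (out_arcs G v)"
    by (rule inj_onI, rule no_multi_arcs) (auto simp: arc_to_ends_def)
  moreover have "head G ` out_arcs G v = {u \<in> verts G. v \<rightarrow> u}"
    by (force simp: arcs_ends_conv)
  ultimately show ?thesis
    by (metis card_image nbrs_in_def out_degree_def)
qed

lemma fat_coloring_one:
  assumes "verts G \<noteq> {}"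
  shows "fat_coloring G 1 (\<lambda>_. 1)"
proof -
  have "fat_coloring_with G 1 0 (\<lambda>_. 1)"
    using assms nbrs_in_verts
    by (auto simp: fat_coloring_with_def vertex_coloring_def fat_beta_def color_class_def)
  then show ?thesis
    by (auto simp: fat_coloring_def)
qed

lemma fat_coloring_le_card_verts:
  assumes "fat_coloring G k c"
  shows "k \<le> card (verts G)"
proof -
  have "c ` verts G = {1..k}"
    using assms by (auto simp: fat_coloring_def fat_coloring_with_def vertex_coloring_def)
  then show ?thesis
    using card_image_le[of "verts G" c] by simp
qed

text \<open>\<open>GREATEST\<close> is attained because \<open>k = 1\<close> is admissible and the
  number of vertices bounds every admissible \<open>k\<close>.\<close>

lemma fat_coloring_fat_chromatic_number:
  assumes "verts G \<noteq> {}"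
  shows "\<exists>c. fat_coloring G (fat_chromatic_number G) c"
  unfolding fat_chromatic_number_def
proof (rule GreatestI_ex_nat)
  show "\<exists>k c. fat_coloring G k c"
    using fat_coloring_one[OF assms] by blast
  show "k \<le> card (verts G)" if "\<exists>c. fat_coloring G k c" for k
    using that fat_coloring_le_card_verts by blast
qed

lemma fat_coloring_with_bichromatic_arc:
  assumes fat: "fat_coloring_with G k \<alpha> c" and conn: "connected G" and k: "k \<ge> 2"
  shows "\<alpha> > 0" "\<exists>v \<in> verts G. out_degree G v > 0"
proof -
  have im: "c ` verts G = {1..k}" and \<alpha>: "\<alpha> \<ge> 0"
    using fat by (auto simp: fat_coloring_with_def vertex_coloring_def)
  have "1 \<in> c ` verts G" "2 \<in> c ` verts G"
    unfolding im using k by auto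
  then obtain x y where xy: "x \<in> verts G" "y \<in> verts G" "c x = 1" "c y = 2"
    by (metis imageE)
  \<comment> \<open>If no arc joined two colors, connectedness would make \<open>c\<close> constant,
    against \<open>c x = 1\<close> and \<open>c y = 2\<close>.\<close>
  then obtain v u where vu: "v \<rightarrow> u" "c v \<noteq> c u"
    using constant_on_connected[OF conn _ xy(1,2), of c] by fastforce
  then have verts: "v \<in> verts G" "u \<in> verts G" by auto
  have "c u \<in> {1..k}" "v \<notin> color_class G c (c u)"
    using im verts vu by (auto simp: color_class_def)
  then have "real (nbrs_in G v (color_class G c (c u))) = \<alpha> * real (out_degree G v)"
    using fat verts unfolding fat_coloring_with_def by blast
  moreover have "nbrs_in G v (color_class G c (c u)) > 0"
    using vu nbrs_in_pos_iff by blast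
  ultimately have "\<alpha> * real (out_degree G v) > 0" by simp
  then have "\<alpha> > 0 \<and> out_degree G v > 0"
    using \<alpha> by (simp add: zero_less_mult_iff)
  then show "\<alpha> > 0" "\<exists>v \<in> verts G. out_degree G v > 0"
    using verts by auto
qed

lemma fat_coloring_with_own_class:
  assumes "fat_coloring_with G k \<alpha> c" "v \<in> verts G"
  shows "real (nbrs_in G v (color_class G c (c v))) = fat_beta k \<alpha> * real (out_degree G v)"
  using assms unfolding fat_coloring_with_def vertex_coloring_def color_class_def by blast

text \<open>With two colors available, some color differs from that of \<open>v\<close>, and the
  product counts the neighbors of \<open>v\<close> in that class.\<close>

lemma fat_coloring_with_mult_out_degree_in_Ints:
  assumes fat: "fat_coloring_with G k \<alpha> c" and k: "k \<ge> 2" and v: "v \<in> verts G"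
  shows "\<alpha> * real (out_degree G v) \<in> \<int>"
proof -
  obtain i where "i \<in> {1..k}" "i \<noteq> c v"
    using k that[of 1] that[of 2] by (cases "c v = 1") auto
  then have "\<alpha> * real (out_degree G v) = real (nbrs_in G v (color_class G c i))"
    using fat v unfolding fat_coloring_with_def color_class_def by simp
  then show ?thesis by simp
qed

lemma fat_coloring_with_le_Gcd:
  assumes fat: "fat_coloring_with G k \<alpha> c" and conn: "connected G" and k: "k \<ge> 2"
  defines "g \<equiv> Gcd (out_degree G ` verts G)"
  shows "k \<le> g + 1" and "k = g + 1 \<Longrightarrow> fat_beta k \<alpha> = 0"
proof -
  obtain w where w: "w \<in> verts G" "out_degree G w > 0"
    using fat_coloring_with_bichromatic_arc(2)[OF fat conn k] by blast
  have \<alpha>: "\<alpha> > 0"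
    using fat_coloring_with_bichromatic_arc(1)[OF fat conn k] .
  \<comment> \<open>The product is a neighbor count; the positive degree of \<open>w\<close> lets
    the sign pass to \<open>fat_beta k \<alpha>\<close>.\<close>
  have "fat_beta k \<alpha> * real (out_degree G w) \<ge> 0"
    using fat_coloring_with_own_class[OF fat w(1)] by (metis of_nat_0_le_iff)
  then have \<beta>: "(real k - 1) * \<alpha> \<le> 1"
    using w(2) by (simp add: zero_le_mult_iff fat_beta_def)
  have "g > 0"
    using w by (fastforce simp: g_def intro: Nat.gr0I)
  moreover have "\<alpha> * real g \<in> \<int>"
    unfolding g_def using fat_coloring_with_mult_out_degree_in_Ints[OF fat k]
    by (intro mult_Gcd_in_Ints) auto
  \<comment> \<open>A positive integer is at least 1.\<close>
  ultimately have ag: "\<alpha> * real g \<ge> 1"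
    using \<alpha> Ints_nonzero_abs_ge1[of "\<alpha> * real g"] by simp
  have "real k - 1 \<le> (real k - 1) * (\<alpha> * real g)"
    using mult_left_mono[OF ag, of "real k - 1"] k by simp
  also have "\<dots> = (real k - 1) * \<alpha> * real g" by simp
  finally have lower: "real k - 1 \<le> (real k - 1) * \<alpha> * real g" .
  also have "\<dots> \<le> real g"
    using mult_right_mono[OF \<beta>, of "real g"] by simp
  finally show "k \<le> g + 1" by simp
  assume "k = g + 1"
  \<comment> \<open>Here \<open>real k - 1\<close> is \<open>real g\<close>, so this is
    \<open>ag\<close> again.\<close>
  then have "(real k - 1) * \<alpha> \<ge> 1"
    using ag by (simp add: mult.commute)
  then show "fat_beta k \<alpha> = 0"
    using \<beta> by (simp add: fat_beta_def)
qed

lemma card_verts_le_1_if_Gcd_0: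
  assumes "connected G" "Gcd (out_degree G ` verts G) = 0"
  shows "card (verts G) \<le> 1"
proof -
  have "out_degree G v = 0" if "v \<in> verts G" for v
    using assms(2) that by auto
  \<comment> \<open>The constant coloring \<open>0\<close> has all of \<open>verts G\<close> as its
    class, so a degree of zero excludes every neighbor.\<close>
  then have "\<not> u \<rightarrow> v" for u v
    using nbrs_in_verts[of u] nbrs_in_pos_iff[of u "\<lambda>_. 0" 0] adj_in_verts(1)[of u v]
    by (auto simp: color_class_def)
  then have "u = v" if "u \<in> verts G" "v \<in> verts G" for u v
    using constant_on_connected[OF assms(1), of "\<lambda>x. x"] that by blast
  then show ?thesis
    by (simp add: card_le_Suc0_iff_eq)
qed

end

theorem theorem2p18:
  fixes G :: "('a, 'b) pre_digraph"
  assumes "graph G"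
    and "Digraph_Component.connected G"
  shows "fat_chromatic_number G \<le> Gcd (out_degree G ` verts G) + 1 \<and>
    (fat_chromatic_number G = Gcd (out_degree G ` verts G) + 1 \<longrightarrow>
      (\<forall>c. fat_coloring G (fat_chromatic_number G) c \<longrightarrow>
        (\<forall>v \<in> verts G. nbrs_in G v (color_class G c (c v)) = 0) \<and>
        (card (verts G) \<ge> 2 \<longrightarrow>
          proper_equitable_coloring G (fat_chromatic_number G) c)))"
proof -
  interpret graph G by fact
  note conn = assms(2)
  define k where "k = fat_chromatic_number G"
  define g where "g = Gcd (out_degree G ` verts G)"
  have "verts G \<noteq> {}"
    using conn by (auto simp: connected_def strongly_connected_def)
  then obtain c \<alpha> where c: "fat_coloring_with G k \<alpha> c"
    using fat_coloring_fat_chromatic_number by (auto simp: k_def fat_coloring_def)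
  \<comment> \<open>For \<open>k < 2\<close> the bound is immediate.\<close>
  have le: "k \<le> g + 1"
    using fat_coloring_with_le_Gcd(1)[OF c conn] by (cases "k \<ge> 2") (auto simp: g_def)
  have "(\<forall>v \<in> verts G. nbrs_in G v (color_class G d (d v)) = 0) \<and>
      (card (verts G) \<ge> 2 \<longrightarrow> proper_equitable_coloring G k d)"
    if eq: "k = g + 1" and d: "fat_coloring G k d" for d
  proof -
    obtain \<gamma> where \<gamma>: "fat_coloring_with G k \<gamma> d"
      using d by (auto simp: fat_coloring_def)
    show ?thesis
    proof (cases "g = 0")
      \<comment> \<open>Now \<open>k = 1\<close>, where \<open>fat_beta\<close> is 1 rather than 0:
        own-class counts vanish because all degrees do, and the second claim is vacuous.\<close>
      case True
      then have "out_degree G v = 0" if "v \<in> verts G" for v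
        using that by (auto simp: g_def)
      moreover have "card (verts G) \<le> 1"
        using card_verts_le_1_if_Gcd_0[OF conn] True by (simp add: g_def)
      ultimately show ?thesis
        using fat_coloring_with_own_class[OF \<gamma>] by auto
    next
      case False
      then have "k \<ge> 2"
        using eq by simp
      then have "fat_beta k \<gamma> = 0"
        using fat_coloring_with_le_Gcd(2)[OF \<gamma> conn] eq by (simp add: g_def)
      then show ?thesis
        using fat_coloring_with_own_class[OF \<gamma>] \<gamma> by (auto simp: proper_equitable_coloring_def)
    qed
  qed
  then show ?thesis
    using le unfolding k_def g_def by blast
qed

end
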